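(* The capacitance matrix $\mathcal C\in\mathbb R^{N\times N}$ is positive-definite, i.e. $\mathbf d^T\mathcal C\mathbf d>0$ for every nonzero $\mathbf d\in\mathbb R^N$.
   Context: Fix $N\ge1$ and radii $r_1^+>r_1^->r_2^+>r_2^->\dots>r_N^+>r_N^->0$. The capacitance matrix of the $N$ concentric shells $\{r_j^-<|x|<r_j^+\}\subset\mathbb R^3$ is the symmetric tridiagonal $N\times N$ matrix $$\mathcal C_{ij}=-c_{j-1}\delta_{i,j-1}+(c_{j-1}+c_j)\delta_{i,j}-c_j\delta_{i,j+1},\quad c_j=4\pi\frac{r_j^-r_{j+1}^+}{r_j^--r_{j+1}^+}\ (1\le j\le N-1),\ c_0=4\pi r_1^+,\ c_N=0,$$ where $\delta_{i,j}$ is the Kronecker delta. *)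

theory Defs
  imports Complex_Main "Jordan_Normal_Form.Matrix"
begin

(* The radii are functions rp, rm :: nat => real with rp j = r_j^+ and rm j = r_j^-,
   for 1 <= j <= N; their values at other indices are never used. *)

definition shell_coeff :: "nat \<Rightarrow> (nat \<Rightarrow> real) \<Rightarrow> (nat \<Rightarrow> real) \<Rightarrow> nat \<Rightarrow> real" where
  "shell_coeff N rp rm j =
     (if j = 0 then 4 * pi * rp 1
      else if j = N then 0
      else 4 * pi * (rm j * rp (j + 1) / (rm j - rp (j + 1))))"

(* Indices i, j range over {1..N}, so j - 1 is not truncated. *)

definition capacitance_entry ::
  "nat \<Rightarrow> (nat \<Rightarrow> real) \<Rightarrow> (nat \<Rightarrow> real) \<Rightarrow> nat \<Rightarrow> nat \<Rightarrow> real" where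
  "capacitance_entry N rp rm i j =
     (let c = shell_coeff N rp rm in
        - c (j - 1) * of_bool (i = j - 1)
        + (c (j - 1) + c j) * of_bool (i = j)
        - c j * of_bool (i = j + 1))"

(* Library matrices are indexed from 0, hence the shift. *)

definition capacitance_matrix ::
  "nat \<Rightarrow> (nat \<Rightarrow> real) \<Rightarrow> (nat \<Rightarrow> real) \<Rightarrow> real mat" where
  "capacitance_matrix N rp rm =
     mat N N (\<lambda>(i, j). capacitance_entry N rp rm (i + 1) (j + 1))"

(* Symmetry is not part of this notion. *)

definition positive_definite_mat :: "nat \<Rightarrow> real mat \<Rightarrow> bool" where
  "positive_definite_mat n A \<longleftrightarrow>
     A \<in> carrier_mat n n \<and>
     (\<forall>d \<in> carrier_vec n. d \<noteq> 0\<^sub>v n \<longrightarrow> d \<bullet> (A *\<^sub>v d) > 0)"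

end

theory Submission
  imports Defs
begin

text \<open>
  The capacitance matrix is a weighted path-graph Laplacian with one Dirichlet end. Extend a vector
  \<open>d\<close> by zero to a sequence \<open>u\<close> with \<open>u\<^sub>k = d\<^sub>k\<close> for \<open>1 \<le> k \<le> N\<close>. Row \<open>k\<close> of the matrix then
  computes the difference
  of the fluxes \<open>c\<^sub>k\<^sub>-\<^sub>1 (u\<^sub>k - u\<^sub>k\<^sub>-\<^sub>1)\<close> and \<open>c\<^sub>k (u\<^sub>k\<^sub>+\<^sub>1 - u\<^sub>k)\<close>
  (\<open>capacitance_matrix_mult_vec\<close>). Summation by parts (\<open>sum_by_parts_flux\<close>), whose boundary terms
  vanish because \<open>u\<^sub>0 = 0\<close> and \<open>c\<^sub>N = 0\<close>, turns the quadratic form into the Dirichlet energy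
  \<open>c\<^sub>0 (u\<^sub>1 - u\<^sub>0)\<^sup>2 + \<dots> + c\<^sub>N\<^sub>-\<^sub>1 (u\<^sub>N - u\<^sub>N\<^sub>-\<^sub>1)\<^sup>2\<close>.
  The nesting of the radii makes every weight positive, so the energy is nonnegative and vanishes only
  if \<open>u\<close> is constant on \<open>0, \<dots>, N\<close>; the constant is \<open>u\<^sub>0 = 0\<close>. It is the weight \<open>c\<^sub>0\<close>
  that makes the form definite and not merely semidefinite.
\<close>

lemma sum_by_parts_flux:
  fixes u c :: "nat \<Rightarrow> 'a :: comm_ring_1"
  assumes "u 0 = 0"
  shows "(\<Sum>k<n. u (Suc k) * (c k * (u (Suc k) - u k) - c (Suc k) * (u (Suc (Suc k)) - u (Suc k))))
       = (\<Sum>k<n. c k * (u (Suc k) - u k)\<^sup>2) - u n * (c n * (u (Suc n) - u n))"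
  by (induction n) (simp_all add: assms algebra_simps power2_eq_square)

lemma dirichlet_energy_pos:
  fixes u c :: "nat \<Rightarrow> 'a :: linordered_idom"
  assumes "u 0 = 0"
    and c_pos: "\<And>k. k < n \<Longrightarrow> c k > 0"
    and "m \<le> n" "u m \<noteq> 0"
  shows "(\<Sum>k<n. c k * (u (Suc k) - u k)\<^sup>2) > 0"
proof -
  have "\<exists>k<m. u (Suc k) \<noteq> u k"
  proof (rule ccontr)
    assume "\<not> ?thesis"
    then have step: "u (Suc k) = u k" if "k < m" for k
      using that by blast
    have "u k = u 0" if "k \<le> m" for k
      using that by (induction k) (simp_all add: step Suc_le_eq)
    from this[of m] show False
      using \<open>u 0 = 0\<close> \<open>u m \<noteq> 0\<close> by simp
  qed
  then obtain k where "k < n" "u (Suc k) \<noteq> u k"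
    using \<open>m \<le> n\<close> less_le_trans by blast
  then show ?thesis
    by (intro sum_pos2[of _ k]) (auto simp: c_pos less_imp_le)
qed

lemma inner_radius_pos:
  fixes rp rm :: "nat \<Rightarrow> real"
  assumes "\<And>j. 1 \<le> j \<Longrightarrow> j \<le> N \<Longrightarrow> rp j > rm j"
    and "\<And>j. 1 \<le> j \<Longrightarrow> j < N \<Longrightarrow> rm j > rp (j + 1)"
    and "rm N > 0"
    and "1 \<le> j" "j \<le> N"
  shows "rm j > 0"
  using \<open>j \<le> N\<close> \<open>1 \<le> j\<close>
proof (induction j rule: inc_induct)
  case base
  show ?case by fact
next
  case (step j)
  then show ?case
    using assms(1)[of "Suc j"] assms(2)[of j] by simp
qed

lemma shell_coeff_pos:
  fixes rp rm :: "nat \<Rightarrow> real"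
  assumes "\<And>j. 1 \<le> j \<Longrightarrow> j \<le> N \<Longrightarrow> rp j > rm j"
    and "\<And>j. 1 \<le> j \<Longrightarrow> j < N \<Longrightarrow> rm j > rp (j + 1)"
    and "rm N > 0"
    and "j < N"
  shows "shell_coeff N rp rm j > 0"
proof -
  have "rm k > 0" if "1 \<le> k" "k \<le> N" for k
    using inner_radius_pos[OF assms(1-3) that] .
  then have rp_pos: "rp (j + 1) > 0"
    using assms(1)[of "j + 1"] less_trans[of 0 "rm (j + 1)" "rp (j + 1)"] \<open>j < N\<close> by simp
  show ?thesis
  proof (cases "j = 0")
    case True
    then show ?thesis
      using rp_pos by (simp add: shell_coeff_def)
  next
    case False
    then have "rm j > rp (j + 1)"
      using assms(2) \<open>j < N\<close> by simp
    with rp_pos False \<open>j < N\<close> show ?thesis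
      by (simp add: shell_coeff_def)
  qed
qed

text \<open>
  Vectors are indexed from 0, while the sequence is shifted by one, which leaves index 0 free for the
  boundary value.
\<close>

definition zero_extend :: "real vec \<Rightarrow> nat \<Rightarrow> real" where
  "zero_extend d k = (if 1 \<le> k \<and> k \<le> dim_vec d then d $ (k - 1) else 0)"

text \<open>
  In an interior row this is the tridiagonal shape of the matrix. The extension by zero supplies the
  neighbour that the first row lacks, and in the last row the missing off-diagonal entry would be
  \<open>- c\<^sub>N\<close> and meets the value 0.
\<close>

lemma capacitance_matrix_mult_vec:
  fixes N rp rm d
  defines "c \<equiv> shell_coeff N rp rm" and "u \<equiv> zero_extend d"
  assumes d: "d \<in> carrier_vec N" and i: "i < N"
  shows "(capacitance_matrix N rp rm *\<^sub>v d) $ i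
       = c i * (u (Suc i) - u i) - c (Suc i) * (u (Suc (Suc i)) - u (Suc i))"
proof -
  have "(capacitance_matrix N rp rm *\<^sub>v d) $ i
      = (\<Sum>j<N. capacitance_entry N rp rm (i + 1) (j + 1) * d $ j)"
    using d i by (simp add: capacitance_matrix_def scalar_prod_def atLeast0LessThan)
  also have "\<dots> = (\<Sum>j<N. (if j = i + 1 then - c (Suc i) * d $ j else 0)
                       + (if j = i then (c i + c (Suc i)) * d $ j else 0)
                       + (if i = j + 1 then - c i * d $ j else 0))"
    by (intro sum.cong) (auto simp: capacitance_entry_def c_def Let_def)
  also have "\<dots> = - c (Suc i) * u (Suc (Suc i)) + (c i + c (Suc i)) * u (Suc i) - c i * u i"
  proof -
    have "(\<Sum>j<N. if j = i + 1 then - c (Suc i) * d $ j else 0) = - c (Suc i) * u (Suc (Suc i))"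
      using d by (simp add: sum.delta u_def zero_extend_def)
    moreover have "(\<Sum>j<N. if j = i then (c i + c (Suc i)) * d $ j else 0)
        = (c i + c (Suc i)) * u (Suc i)"
      using d i by (simp add: sum.delta u_def zero_extend_def)
    moreover have "(\<Sum>j<N. if i = j + 1 then - c i * d $ j else 0) = - c i * u i"
      using d i by (cases i) (simp_all add: sum.delta' u_def zero_extend_def)
    ultimately show ?thesis
      by (simp add: sum.distrib)
  qed
  finally show ?thesis
    by (simp add: algebra_simps)
qed

theorem lemma3p4:
  fixes N :: nat and rp rm :: "nat \<Rightarrow> real"
  assumes "N \<ge> 1"
    and "\<And>j. 1 \<le> j \<Longrightarrow> j \<le> N \<Longrightarrow> rp j > rm j"
    and "\<And>j. 1 \<le> j \<Longrightarrow> j < N \<Longrightarrow> rm j > rp (j + 1)"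
    and "rm N > 0"
  shows "positive_definite_mat N (capacitance_matrix N rp rm)"
  unfolding positive_definite_mat_def
proof (intro conjI ballI impI)
  show "capacitance_matrix N rp rm \<in> carrier_mat N N"
    by (simp add: capacitance_matrix_def)
next
  fix d :: "real vec"
  assume d: "d \<in> carrier_vec N" and "d \<noteq> 0\<^sub>v N"
  define c where "c = shell_coeff N rp rm"
  define u where "u = zero_extend d"
  have u0: "u 0 = 0"
    by (simp add: u_def zero_extend_def)
  have u_Suc: "u (Suc i) = d $ i" if "i < N" for i
    using d that by (simp add: u_def zero_extend_def)
  have cN: "c N = 0"
    using \<open>N \<ge> 1\<close> by (simp add: c_def shell_coeff_def)
  have "d \<bullet> (capacitance_matrix N rp rm *\<^sub>v d)
      = (\<Sum>i<N. d $ i * (capacitance_matrix N rp rm *\<^sub>v d) $ i)"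
    by (simp add: scalar_prod_def atLeast0LessThan capacitance_matrix_def)
  also have "\<dots> = (\<Sum>i<N. u (Suc i) *
      (c i * (u (Suc i) - u i) - c (Suc i) * (u (Suc (Suc i)) - u (Suc i))))"
    by (intro sum.cong refl)
      (simp only: lessThan_iff capacitance_matrix_mult_vec[OF d] u_Suc flip: c_def u_def)
  also have "\<dots> = (\<Sum>i<N. c i * (u (Suc i) - u i)\<^sup>2)"
    by (simp only: sum_by_parts_flux[where u = u, OF u0] cN mult_zero_left mult_zero_right diff_zero)
  also have "\<dots> > 0"
  proof -
    obtain i where "i < N" "d $ i \<noteq> 0"
      using \<open>d \<noteq> 0\<^sub>v N\<close> d by (auto simp: vec_eq_iff)
    moreover have "c k > 0" if "k < N" for k
      unfolding c_def using assms(2-4) that by (rule shell_coeff_pos)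
    ultimately show ?thesis
      by (intro dirichlet_energy_pos[where m = "Suc i"]) (auto simp: u0 u_Suc)
  qed
  finally show "d \<bullet> (capacitance_matrix N rp rm *\<^sub>v d) > 0" .
qed

end
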